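(* There exists a universal positive nonincreasing function $c(d)$ of the positive integer $d$ such that for all positive integers $d,N$ and every $s\in\mathcal S_d$, $$\|F_Ns\|_\infty\ \ge\ c(d)\,N^{1/2}\,\|s_0^{N-1}\|_\infty .$$ One can take $c(d)=\kappa/(d^3\ln(2d))$ with a properly selected positive absolute constant $\kappa$.
   Context: $\mathcal S$ is the space of two-sided real sequences $z=\{z_t\}_{t\in\mathbf Z}$; $z_0^{N-1}=[z_0;\ldots;z_{N-1}]$. $\Delta$ is the shift on $\mathcal S$: $(\Delta z)_t=z_{t-1}$. $\Omega_d$ is the set of unordered collections (multisets) $\mathbf w=\{\omega_1,\ldots,\omega_d\}$ of $d$ reals that are symmetric mod $2\pi$: for every real $a$, the number of $i$ with $\omega_i\equiv a \pmod{2\pi}$ equals the number of $i$ with $\omega_i\equiv -a\pmod{2\pi}$. For $\mathbf w\in\Omega_d$, $p_{\mathbf w}(\zeta)=\prod_{\ell=1}^d(1-\exp\{\imath\omega_\ell\}\zeta)$ (a real polynomial), $\mathcal S[\mathbf w]=\{x\in\mathcal S: p_{\mathbf w}(\Delta)x\equiv 0\}$, and $\mathcal S_d=\bigcup_{\mathbf w\in\Omega_d}\mathcal S[\mathbf w]$. $\Gamma_N$ is the set of complex $N$-th roots of unity; for $s\in\mathcal S$, $[F_Ns](\mu)=N^{-1/2}\sum_{t=0}^{N-1}s_t\mu^t$, $\mu\in\Gamma_N$, and $\|F_Ns\|_\infty=\max_{\mu\in\Gamma_N}|[F_Ns](\mu)|$. *)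

theory Defs
  imports "HOL-Analysis.Analysis" "HOL-Computational_Algebra.Polynomial"
    "HOL-Library.Multiset" "HOL-Library.Real_Mod"
begin

definition shift :: "(int \<Rightarrow> 'a) \<Rightarrow> int \<Rightarrow> 'a" where
  "shift z = (\<lambda>t. z (t - 1))"

definition poly_shift :: "'a::comm_ring_1 poly \<Rightarrow> (int \<Rightarrow> 'a) \<Rightarrow> int \<Rightarrow> 'a" where
  "poly_shift p z = (\<lambda>t. \<Sum>k\<le>degree p. coeff p k * (shift ^^ k) z t)"

definition Omega :: "nat \<Rightarrow> real multiset set" where
  "Omega d = {w. size w = d \<and>
     (\<forall>a::real. size {#\<omega> \<in># w. [\<omega> = a] (rmod (2 * pi))#} =
                size {#\<omega> \<in># w. [\<omega> = -a] (rmod (2 * pi))#})}"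

definition freq_poly :: "real multiset \<Rightarrow> complex poly" where
  "freq_poly w = (\<Prod>\<omega>\<in>#w. [:1, - exp (\<i> * complex_of_real \<omega>):])"

text \<open>For symmetric \<open>w\<close> the coefficients of \<open>freq_poly w\<close> are real; they are kept in the
  complex type, and the real sequence is embedded into the complex ones instead.\<close>

definition S_freq :: "real multiset \<Rightarrow> (int \<Rightarrow> real) set" where
  "S_freq w = {x. poly_shift (freq_poly w) (\<lambda>t. complex_of_real (x t)) = (\<lambda>t. 0)}"

definition S_dim :: "nat \<Rightarrow> (int \<Rightarrow> real) set" where
  "S_dim d = (\<Union>w\<in>Omega d. S_freq w)"

definition roots_unity :: "nat \<Rightarrow> complex set" where
  "roots_unity N = {\<mu>. \<mu> ^ N = 1}"

definition DFT :: "nat \<Rightarrow> (int \<Rightarrow> real) \<Rightarrow> complex \<Rightarrow> complex" where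
  "DFT N s \<mu> = complex_of_real (1 / sqrt (real N)) *
     (\<Sum>t<N. complex_of_real (s (int t)) * \<mu> ^ t)"

text \<open>The two maxima below are over nonempty finite sets only for \<open>N > 0\<close>.\<close>

definition DFT_sup_norm :: "nat \<Rightarrow> (int \<Rightarrow> real) \<Rightarrow> real" where
  "DFT_sup_norm N s = Max ((\<lambda>\<mu>. cmod (DFT N s \<mu>)) ` roots_unity N)"

definition segment_sup_norm :: "nat \<Rightarrow> (int \<Rightarrow> real) \<Rightarrow> real" where
  "segment_sup_norm N s = Max ((\<lambda>t. \<bar>s (int t)\<bar>) ` {..<N})"

definition DFT_lower_factor :: "(nat \<Rightarrow> real) \<Rightarrow> bool" where
  "DFT_lower_factor c \<longleftrightarrow>
     (\<forall>d\<ge>1. c d > 0) \<and> antimono_on {1..} c \<and>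
     (\<forall>d\<ge>1. \<forall>N\<ge>1. \<forall>s\<in>S_dim d.
        DFT_sup_norm N s \<ge> c d * sqrt (real N) * segment_sup_norm N s)"

end

theory Submission
  imports Defs
begin

text \<open>
  Every value \<open>s\<^sub>t\<close> with \<open>t\<close> in the window \<open>0..N-1\<close> is recovered from the window by a filter whose
  Fourier transform has small \<open>\<ell>\<^sub>1\<close> norm; pairing it with the Fourier transform of \<open>s\<close> bounds
  \<open>\<bar>s\<^sub>t\<bar>\<close> by the maximum of the latter.

  Let \<open>f\<close> be a polynomial with \<open>f(0) = 1\<close> that is divisible by \<open>p\<^sub>w\<close>. Then \<open>f(\<Delta>)s = 0\<close>, so
  \<open>\<phi> = 1 - f\<close> satisfies \<open>\<phi>(\<Delta>)s = s\<close>, and so does \<open>\<phi>\<^sup>2\<close>. If \<open>deg \<phi>\<^sup>2 \<le> t < N\<close>, the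
  convolution at time \<open>t\<close> only uses values in the window, and Fourier inversion turns
  \<open>\<phi>\<^sup>2(\<Delta>)s = s\<close> into \<open>N s\<^sub>t = \<Sum>\<^sub>\<mu> S(\<mu>) cnj \<mu>\<^sup>t \<phi>(\<mu>)\<^sup>2\<close>, where \<open>S(\<mu>) = \<Sum>\<^sub>t s\<^sub>t \<mu>\<^sup>t\<close> and \<open>\<mu>\<close> runs over
  the \<open>N\<close>-th roots of unity. Squaring \<open>\<phi>\<close> is what makes the \<open>\<ell>\<^sub>1\<close> norm accessible: since the mean
  of \<open>f\<close> over the roots of unity is \<open>f(0) = 1\<close>,
  \<open>\<Sum>\<^sub>\<mu> \<bar>\<phi>(\<mu>)\<bar>\<^sup>2 = \<Sum>\<^sub>\<mu> \<bar>f(\<mu>)\<bar>\<^sup>2 - N\<close>, which is at most \<open>N (m\<^sup>2 - 1)\<close> if \<open>\<bar>f\<bar> \<le> m\<close> on the unit circle.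
  So \<open>f\<close> should exceed \<open>1\<close> as little as possible on the unit circle.

  Such an \<open>f\<close> is a product of \<open>d\<close> rotated copies of one polynomial \<open>g\<close> of degree about \<open>N / d\<close> with
  \<open>g(0) = 1\<close>, \<open>g(1) = 0\<close> and \<open>\<bar>g\<bar> \<le> 1 + O(d/N)\<close> on the circle
  (lemma \<open>exists_poly_zero_at_one_small_on_circle\<close>). The normalized analytic Fejer sum \<open>W\<close> maps the circle into
  the right half of the unit disc, with \<open>W(1) = 1\<close> and \<open>W(0)\<close> small; the cubic
  \<open>(1 - w) (1 + w\<^sup>2 / 2)\<close> equals \<open>1\<close> at \<open>0\<close>, vanishes at \<open>1\<close> and maps that half disc into the unit
  disc, so \<open>g\<close> is this cubic of \<open>W\<close>, divided by its value at the origin. Hence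
  \<open>\<bar>f\<bar>\<^sup>2 \<le> 1 + O(d\<^sup>2/N)\<close>, which gives \<open>N \<bar>s\<^sub>t\<bar> \<le> 48 d\<^sup>2 max \<bar>S\<bar>\<close> for \<open>t\<close> in the second half of the window
  (lemma \<open>late_value_bound\<close>); reversing time gives the first half. The factor \<open>1 / (48 d\<^sup>2)\<close> obtained
  in this way dominates \<open>\<kappa> / (d\<^sup>3 ln (2 d))\<close> for \<open>\<kappa> = ln 2 / 48\<close>.
\<close>

section \<open>A polynomial with a zero at one, nearly bounded by its value at the origin\<close>

text \<open>
  The linear polynomial \<open>1 - w\<close> alone exceeds \<open>1\<close> in modulus on the imaginary axis, by second order at
  the origin. The factor \<open>1 + w\<^sup>2 / 2\<close> cancels exactly this second-order term. In terms of
  \<open>x = Re w\<close> and \<open>r = \<bar>w\<bar>\<^sup>2\<close> both squared moduli are polynomials, and the claim becomes the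
  inequality \<open>2 x B \<le> (3 r\<^sup>2 - r\<^sup>3) / 4\<close> below.
\<close>

lemma half_disc_bound:
  fixes w :: complex
  assumes "Re w \<ge> 0" "norm w \<le> 1"
  shows "norm ((1 - w) * (1 + w\<^sup>2 / 2)) \<le> 1"
proof -
  define x y r where "x = Re w" and "y = Im w" and "r = x\<^sup>2 + y\<^sup>2"
  have r: "0 \<le> r" "r \<le> 1"
    using assms(2) by (auto simp: r_def x_def y_def cmod_def)
  have x: "0 \<le> x" "x \<le> 1"
    using assms abs_Re_le_cmod[of w] by (auto simp: x_def)
  have y2: "y\<^sup>2 = r - x\<^sup>2" by (simp add: r_def)
  have n1: "(norm (1 - w))\<^sup>2 = 1 + r - 2 * x"
    unfolding cmod_power2 r_def x_def y_def by (simp add: power2_eq_square algebra_simps)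
  have n2: "(norm (1 + w\<^sup>2 / 2))\<^sup>2 = 1 + 2 * x\<^sup>2 - r + r\<^sup>2 / 4"
  proof -
    have "(norm (1 + w\<^sup>2 / 2))\<^sup>2 = (1 + (x\<^sup>2 - y\<^sup>2) / 2)\<^sup>2 + (x * y)\<^sup>2"
      unfolding cmod_power2 x_def y_def by (simp add: power2_eq_square)
    also have "\<dots> = 1 + 2 * x\<^sup>2 - r + r\<^sup>2 / 4"
      unfolding r_def by (simp add: power2_eq_square field_simps)
    finally show ?thesis .
  qed
  define B where "B = x * (1 + r) - 2 * x\<^sup>2 - (1 - r / 2)\<^sup>2"
  (* B is at most its maximum over x, attained at x = (1 + r) / 4; the remaining inequality in r
     is sharp at r = 1. *)
  have B: "2 * B \<le> (3 * r\<^sup>2 - r^3) / 4"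
  proof -
    have "0 \<le> ((1 + r) - 4 * x)\<^sup>2" by simp
    hence "x * (1 + r) - 2 * x\<^sup>2 \<le> (1 + r)\<^sup>2 / 8"
      by (simp add: power2_eq_square field_simps)
    moreover have "(3 * r\<^sup>2 - r^3) / 4 - 2 * ((1 + r)\<^sup>2 / 8 - (1 - r / 2)\<^sup>2)
                   = (1 - r) * ((7 - 3 * r + r\<^sup>2) / 4)"
      by (simp add: power2_eq_square power3_eq_cube field_simps)
    moreover have "0 \<le> (1 - r) * ((7 - 3 * r + r\<^sup>2) / 4)"
      using r by (intro mult_nonneg_nonneg) auto
    ultimately show ?thesis unfolding B_def by argo
  qed
  have "0 \<le> r\<^sup>2 * (3 - r)" using r by (intro mult_nonneg_nonneg) auto
  hence nn: "0 \<le> (3 * r\<^sup>2 - r^3) / 4" by (simp add: power2_eq_square power3_eq_cube algebra_simps)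
  have "2 * x * B \<le> (3 * r\<^sup>2 - r^3) / 4"
  proof (cases "B \<ge> 0")
    case True
    have "x * (2 * B) \<le> 1 * (2 * B)" using x True by (intro mult_right_mono) auto
    thus ?thesis using B by (simp add: mult_ac)
  next
    case False
    hence "2 * x * B \<le> 0" using x by (intro mult_nonneg_nonpos) auto
    thus ?thesis using nn by linarith
  qed
  moreover have "(1 + r - 2 * x) * (1 + 2 * x\<^sup>2 - r + r\<^sup>2 / 4)
                 = 1 + 2 * x * B - (3 * r\<^sup>2 - r^3) / 4"
    unfolding B_def by (simp add: power2_eq_square power3_eq_cube field_simps)
  ultimately have "(norm ((1 - w) * (1 + w\<^sup>2 / 2)))\<^sup>2 \<le> 1"
    unfolding norm_mult power_mult_distrib n1 n2 by linarith
  thus ?thesis by (simp add: power_le_one_iff abs_square_le_1)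
qed

text \<open>
  This is \<open>n + 2 \<Sum>\<^sub>j (n - j) z\<^sup>j\<close>, summed over \<open>0 < j < n\<close>: the analytic polynomial whose real part
  on the unit circle is \<open>n\<close> times the Fejer kernel. Its form as a sum of partial sums makes recursion on
  \<open>n\<close> immediate.
\<close>

definition fejer :: "nat \<Rightarrow> complex poly" where
  "fejer n = (\<Sum>k<n. 2 * (\<Sum>j\<le>k. monom 1 j) - 1)"

lemma poly_fejer: "poly (fejer n) z = (\<Sum>k<n. 2 * (\<Sum>j\<le>k. z ^ j) - 1)"
  by (simp add: fejer_def poly_sum poly_monom)

lemma degree_fejer: "degree (fejer n) \<le> n - 1"
  unfolding fejer_def
proof (rule degree_sum_le)
  fix k assume k: "k \<in> {..<n}"
  have "degree (\<Sum>j\<le>k. monom (1::complex) j) \<le> k"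
    by (intro degree_sum_le) (auto intro: order.trans[OF degree_monom_le])
  hence "degree (2 * (\<Sum>j\<le>k. monom (1::complex) j) - 1) \<le> k"
    by (intro degree_diff_le order.trans[OF degree_mult_le]) auto
  thus "degree (2 * (\<Sum>j\<le>k. monom (1::complex) j) - 1) \<le> n - 1"
    using k by auto
qed auto

lemma sum_two_mult_minus_one: "(\<Sum>k<n. 2 * of_nat (Suc k) - 1) = (of_nat n ^ 2 :: 'a::comm_ring_1)"
  by (induction n) (auto simp: power2_eq_square algebra_simps)

lemma poly_fejer_0: "poly (fejer n) 0 = of_nat n"
  by (simp add: poly_fejer power_0_left)

lemma poly_fejer_1: "poly (fejer n) 1 = of_nat n ^ 2"
  using sum_two_mult_minus_one[of n, where ?'a = complex] by (simp add: poly_fejer)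

lemma unit_power_mult_cnj:
  assumes "norm z = 1" "k \<le> n"
  shows "z ^ n * cnj z ^ k = z ^ (n - k)"
proof -
  have "z * cnj z = 1"
    using assms(1) by (simp only: complex_norm_square[symmetric]) simp
  hence "z ^ k * cnj z ^ k = 1"
    by (metis power_mult_distrib power_one)
  moreover have "z ^ n = z ^ (n - k) * z ^ k"
    using assms(2) by (metis le_add_diff_inverse2 power_add)
  ultimately show ?thesis by (simp only: mult.assoc mult_1_right)
qed

text \<open>
  Nonnegativity of the Fejer kernel, by induction: adding \<open>z\<^sup>n\<close> to the geometric sum contributes to
  its squared modulus the square of the new term and twice the real part of its products with the old
  terms, which are the powers \<open>z\<^sup>1, ..., z\<^sup>n\<close>.
\<close>

lemma Re_poly_fejer:
  assumes "norm z = 1"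
  shows "Re (poly (fejer n) z) = (norm (\<Sum>j<n. z ^ j))\<^sup>2"
proof (induction n)
  case 0
  thus ?case by (simp add: poly_fejer)
next
  case (Suc n)
  have reindex: "(\<Sum>j<n. z ^ (n - j)) = (\<Sum>j<n. z ^ Suc j)"
    by (rule sum.reindex_bij_witness[of _ "\<lambda>j. n - Suc j" "\<lambda>j. n - Suc j"])
       (auto simp: Suc_diff_Suc)
  have "(norm (\<Sum>j<Suc n. z ^ j))\<^sup>2 = (norm (\<Sum>j<n. z ^ j))\<^sup>2 + (norm (z ^ n))\<^sup>2
          + 2 * Re (z ^ n * cnj (\<Sum>j<n. z ^ j))"
    unfolding cmod_power2 sum.lessThan_Suc
    by (simp only: plus_complex.sel times_complex.sel complex_cnj power2_eq_square) (simp only: algebra_simps cnj.sel)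
  also have "z ^ n * cnj (\<Sum>j<n. z ^ j) = (\<Sum>j<n. z ^ (n - j))"
    by (subst cnj_sum, subst sum_distrib_left, intro sum.cong) (auto simp: unit_power_mult_cnj assms)
  also have "\<dots> = (\<Sum>j\<le>n. z ^ j) - 1"
    unfolding reindex by (simp add: sum.atMost_shift)
  finally show ?case
    using Suc assms by (simp add: poly_fejer norm_power)
qed

lemma norm_poly_fejer_le:
  assumes "norm z = 1"
  shows "norm (poly (fejer n) z) \<le> real n ^ 2"
proof -
  have "norm (2 * (\<Sum>j\<le>k. z ^ j) - 1) \<le> 2 * real (Suc k) - 1" for k
  proof -
    have "2 * (\<Sum>j\<le>k. z ^ j) - 1 = 1 + 2 * (\<Sum>j<k. z ^ Suc j)"
      by (simp add: sum.atMost_shift algebra_simps)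
    also have "norm \<dots> \<le> 1 + 2 * (\<Sum>j<k. norm (z ^ Suc j))"
      by (intro norm_triangle_le add_mono) (auto simp: norm_mult simp del: power_Suc intro!: norm_sum)
    also have "\<dots> = 2 * real (Suc k) - 1" using assms by (simp add: norm_power norm_mult)
    finally show ?thesis .
  qed
  hence "norm (poly (fejer n) z) \<le> (\<Sum>k<n. 2 * real (Suc k) - 1)"
    unfolding poly_fejer by (intro order.trans[OF norm_sum] sum_mono)
  also have "\<dots> = real n ^ 2" by (rule sum_two_mult_minus_one)
  finally show ?thesis .
qed

text \<open>
  By the maximum principle a nonconstant polynomial with value \<open>1\<close> at the origin exceeds \<open>1\<close> in
  modulus somewhere on the circle; an excess of order \<open>1/n\<close> at degree of order \<open>n\<close> is what the
  final bound needs. The excess comes only from \<open>W(0) = 1/n\<close>: the cubic of \<open>W\<close> is bounded by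
  \<open>1\<close> and takes a value of at least \<open>1 - 1/n\<close> at the origin.
\<close>

lemma exists_poly_zero_at_one_small_on_circle:
  assumes "n \<ge> 2"
  obtains g :: "complex poly" where "degree g \<le> 3 * (n - 1)" "poly g 0 = 1" "poly g 1 = 0"
    "\<And>z. norm z = 1 \<Longrightarrow> norm (poly g z) \<le> 1 / (1 - 1 / real n)"
proof -
  define W where "W = smult (1 / of_nat n ^ 2) (fejer n)"
  define h where "h = (1 - W) * (1 + smult (1/2) (W ^ 2))"
  have poly_h: "poly h z = (1 - poly W z) * (1 + (poly W z)\<^sup>2 / 2)" for z
    by (simp add: h_def)
  have dW: "degree W \<le> n - 1"
    unfolding W_def by (rule order.trans[OF degree_smult_le degree_fejer])
  have "degree (1 - W) \<le> n - 1"
    using dW by (intro degree_diff_le) auto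
  moreover have "degree (1 + smult (1/2) (W ^ 2)) \<le> 2 * (n - 1)"
    using dW by (intro degree_add_le order.trans[OF degree_smult_le] order.trans[OF degree_power_le]) auto
  ultimately have dh: "degree h \<le> 3 * (n - 1)"
    unfolding h_def by (intro order.trans[OF degree_mult_le]) linarith
  have W0: "poly W 0 = of_real (1 / real n)"
    using assms by (simp add: W_def poly_fejer_0 power2_eq_square)
  have W1: "poly W 1 = 1"
    using assms by (simp add: W_def poly_fejer_1)
  define \<gamma> where "\<gamma> = (1 - 1 / real n) * (1 + (1 / real n)\<^sup>2 / 2)"
  have h0: "poly h 0 = of_real \<gamma>"
    by (simp add: poly_h W0 \<gamma>_def)
  have pos: "0 < 1 - 1 / real n" using assms by (simp add: field_simps)
  have "(1 - 1 / real n) * 1 \<le> \<gamma>"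
    unfolding \<gamma>_def using pos by (intro mult_left_mono) auto
  hence \<gamma>: "1 - 1 / real n \<le> \<gamma>" "0 < \<gamma>" using pos unfolding mult_1_right by - linarith+
  have bound: "norm (poly h z) \<le> 1" if "norm z = 1" for z
    unfolding poly_h
  proof (rule half_disc_bound)
    have "poly W z = poly (fejer n) z / of_real (real n ^ 2)"
      by (simp add: W_def)
    moreover have "Re (poly (fejer n) z) \<ge> 0" using that by (simp add: Re_poly_fejer)
    moreover have "norm (poly (fejer n) z) \<le> real n ^ 2" using norm_poly_fejer_le[OF that] .
    ultimately show "Re (poly W z) \<ge> 0" "norm (poly W z) \<le> 1"
      using assms by (simp_all only: Re_divide_of_real norm_divide norm_of_real) (auto simp: field_simps)
  qed
  show thesis
  proof (rule that[of "smult (of_real (1 / \<gamma>)) h"])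
    show "degree (smult (complex_of_real (1 / \<gamma>)) h) \<le> 3 * (n - 1)"
      by (rule order.trans[OF degree_smult_le dh])
    show "poly (smult (complex_of_real (1 / \<gamma>)) h) 0 = 1"
      using \<gamma> by (simp add: h0)
    show "poly (smult (complex_of_real (1 / \<gamma>)) h) 1 = 0"
      by (simp add: poly_h W1)
    fix z :: complex assume z: "norm z = 1"
    have "norm (poly (smult (complex_of_real (1 / \<gamma>)) h) z) = norm (poly h z) / \<gamma>"
      using \<gamma> by (simp add: norm_mult norm_divide)
    also have "\<dots> \<le> 1 / (1 - 1 / real n)"
      using bound[OF z] \<gamma> pos by (intro frac_le) auto
    finally show "norm (poly (smult (complex_of_real (1 / \<gamma>)) h) z) \<le> 1 / (1 - 1 / real n)" .
  qed
qed

text \<open>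
  Rotating the zero of \<open>g\<close> from \<open>1\<close> to \<open>exp (- \<i> \<omega>)\<close> keeps its value at the origin and its bound on
  the circle, so multiplying one rotated copy per frequency multiplies the bounds.
\<close>

lemma exists_freq_poly_multiple:
  assumes "n \<ge> 2"
  obtains f where "degree f \<le> 3 * (n - 1) * size w" "poly f 0 = 1" "freq_poly w dvd f"
    "\<And>z. norm z = 1 \<Longrightarrow> norm (poly f z) \<le> (1 / (1 - 1 / real n)) ^ size w"
proof -
  obtain g :: "complex poly" where g: "degree g \<le> 3 * (n - 1)" "poly g 0 = 1" "poly g 1 = 0"
    "\<And>z. norm z = 1 \<Longrightarrow> norm (poly g z) \<le> 1 / (1 - 1 / real n)"
    using exists_poly_zero_at_one_small_on_circle[OF assms] by blast
  from g(3) obtain q where q: "g = [:- 1, 1:] * q"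
    by (auto simp: poly_eq_0_iff_dvd)
  have "\<exists>f. degree f \<le> 3 * (n - 1) * size w \<and> poly f 0 = 1 \<and> freq_poly w dvd f \<and>
    (\<forall>z. norm z = 1 \<longrightarrow> norm (poly f z) \<le> (1 / (1 - 1 / real n)) ^ size w)"
  proof (induction w)
    case empty
    show ?case by (intro exI[of _ 1]) (auto simp: freq_poly_def)
  next
    case (add \<omega> w)
    then obtain f where f: "degree f \<le> 3 * (n - 1) * size w" "poly f 0 = 1" "freq_poly w dvd f"
      "\<And>z. norm z = 1 \<Longrightarrow> norm (poly f z) \<le> (1 / (1 - 1 / real n)) ^ size w"
      by blast
    define e where "e = exp (\<i> * complex_of_real \<omega>)"
    have e: "norm e = 1" by (simp add: e_def)
    (* the copy of g rotated so that its zero is the one of the factor of omega *)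
    define h where "h = pcompose g [:0, e:]"
    have "pcompose [:- 1, 1:] [:0, e:] = - [:1, - e:]"
      by (simp add: pcompose_pCons)
    hence "h = - [:1, - e:] * pcompose q [:0, e:]"
      unfolding h_def q pcompose_mult by (simp only:)
    hence dvd: "[:1, - e:] dvd h" by (simp only: mult_minus_left dvd_minus_iff dvd_triv_left)
    have "degree h \<le> degree g * degree [:0, e:]"
      unfolding h_def by (rule degree_pcompose_le)
    also have "\<dots> \<le> 3 * (n - 1)" using g(1) by simp
    finally have dh: "degree h \<le> 3 * (n - 1)" .
    have "degree (h * f) \<le> 3 * (n - 1) * size (add_mset \<omega> w)"
      using degree_mult_le[of h f] dh f(1) by simp
    moreover have "poly (h * f) 0 = 1"
      by (simp add: h_def poly_pcompose g f)
    moreover have "freq_poly (add_mset \<omega> w) dvd h * f"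
      using mult_dvd_mono[OF dvd f(3)] by (simp add: freq_poly_def e_def)
    moreover have "norm (poly (h * f) z) \<le> (1 / (1 - 1 / real n)) ^ size (add_mset \<omega> w)"
      if z: "norm z = 1" for z
    proof -
      have "norm (poly g (z * e)) \<le> 1 / (1 - 1 / real n)"
        using z e by (intro g(4)) (simp add: norm_mult)
      moreover have "0 \<le> 1 / (1 - 1 / real n)" using assms by (simp add: field_simps)
      ultimately have "norm (poly g (z * e)) * norm (poly f z)
          \<le> 1 / (1 - 1 / real n) * (1 / (1 - 1 / real n)) ^ size w"
        using f(4)[OF z] by (intro mult_mono) auto
      thus ?thesis by (simp add: h_def poly_pcompose norm_mult)
    qed
    ultimately show ?case by blast
  qed
  thus ?thesis using that by blast
qed

section \<open>Polynomials in the shift\<close>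

lemma shift_funpow: "(shift ^^ k) z t = z (t - int k)"
  by (induction k arbitrary: t) (auto simp: shift_def algebra_simps)

lemma poly_shift_eq:
  assumes "degree p \<le> n"
  shows "poly_shift p z t = (\<Sum>k\<le>n. coeff p k * z (t - int k))"
  unfolding poly_shift_def shift_funpow using assms
  by (intro sum.mono_neutral_left) (auto simp: coeff_eq_0)

lemma poly_shift_add: "poly_shift (p + q) z t = poly_shift p z t + poly_shift q z t"
proof -
  define n where "n = max (degree p) (degree q)"
  have "degree p \<le> n" "degree q \<le> n" "degree (p + q) \<le> n"
    by (auto simp: n_def degree_add_le_max)
  thus ?thesis by (simp add: poly_shift_eq[of _ n] sum.distrib algebra_simps)
qed

lemma poly_shift_smult: "poly_shift (smult a p) z t = a * poly_shift p z t"
  by (simp add: poly_shift_eq[of _ "degree p"] degree_smult_le sum_distrib_left mult.assoc)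

lemma poly_shift_pCons_0: "poly_shift (pCons 0 p) z t = poly_shift p z (t - 1)"
proof -
  have "poly_shift (pCons 0 p) z t = (\<Sum>k\<le>Suc (degree p). coeff (pCons 0 p) k * z (t - int k))"
    by (intro poly_shift_eq) (simp add: degree_pCons_le)
  also have "\<dots> = poly_shift p z (t - 1)"
    by (subst sum.atMost_Suc_shift) (simp add: poly_shift_eq[of p "degree p"] algebra_simps)
  finally show ?thesis .
qed

text \<open>
  The polynomials annihilating a given sequence form an ideal, because \<open>poly_shift\<close> is linear in the
  polynomial and multiplication by the variable is a shift of time.
\<close>

lemma poly_shift_dvd:
  assumes "p dvd f" "poly_shift p z = (\<lambda>t. 0)"
  shows "poly_shift f z = (\<lambda>t. 0)"
proof -
  have "poly_shift (p * q) z = (\<lambda>t. 0)" for q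
  proof (induction q)
    case 0
    show ?case by (simp add: poly_shift_def)
  next
    case (pCons a q)
    show ?case
      using pCons.IH assms(2)
      by (intro ext) (simp add: mult_pCons_right poly_shift_add poly_shift_smult poly_shift_pCons_0)
  qed
  thus ?thesis using assms(1) by (auto elim: dvdE)
qed

lemma poly_shift_1: "poly_shift 1 z t = z t"
  by (simp add: poly_shift_def)

text \<open>
  Reversing time reverses the coefficients of a recurrence; its leading coefficient then acts on the
  earliest value, which accounts for the offset by the degree in the proof.
\<close>

lemma poly_shift_reflect_poly:
  assumes "coeff p 0 \<noteq> 0" "poly_shift p z = (\<lambda>t. 0)"
  shows "poly_shift (reflect_poly p) (\<lambda>t. z (T - t)) = (\<lambda>t. 0)"
proof
  fix t
  have "poly_shift (reflect_poly p) (\<lambda>t. z (T - t)) t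
      = (\<Sum>k\<le>degree p. coeff p (degree p - k) * z (T - (t - int k)))"
    by (subst poly_shift_eq[of _ "degree p"]) (auto simp: degree_reflect_poly_le coeff_reflect_poly)
  also have "\<dots> = (\<Sum>k\<le>degree p. coeff p k * z (T - t + int (degree p) - int k))"
    by (rule sum.reindex_bij_witness[of _ "\<lambda>k. degree p - k" "\<lambda>k. degree p - k"])
       (auto simp: of_nat_diff algebra_simps)
  also have "\<dots> = poly_shift p z (T - t + int (degree p))"
    by (simp add: poly_shift_eq[of p "degree p"])
  finally show "poly_shift (reflect_poly p) (\<lambda>t. z (T - t)) t = 0" using assms(2) by simp
qed

text \<open>
  Reflection inverts the roots, and for unimodular roots this means changing the sign of the
  frequencies. The class of sequences under consideration is therefore closed under time reversal.
\<close>

lemma reflect_freq_poly_dvd: "reflect_poly (freq_poly w) dvd freq_poly (image_mset uminus w)"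
proof (induction w)
  case empty
  show ?case by (simp add: freq_poly_def)
next
  case (add \<omega> w)
  define e where "e = exp (\<i> * complex_of_real \<omega>)"
  have e: "exp (- (\<i> * complex_of_real \<omega>)) = inverse e" "e \<noteq> 0"
    by (simp_all add: e_def exp_minus)
  have "reflect_poly [:1, - e:] = [:- e, 1:]"
    using e by (simp add: reflect_poly_pCons)
  also have "\<dots> dvd [:1, - inverse e:]"
    using e by (intro dvdI[of _ _ "[:- inverse e:]"]) simp
  finally have "reflect_poly [:1, - e:] * reflect_poly (freq_poly w)
      dvd [:1, - inverse e:] * freq_poly (image_mset uminus w)"
    by (rule mult_dvd_mono[OF _ add])
  moreover have "freq_poly (add_mset \<omega> w) = [:1, - e:] * freq_poly w"
    by (simp add: freq_poly_def e_def)
  moreover have "freq_poly (image_mset uminus (add_mset \<omega> w))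
      = [:1, - inverse e:] * freq_poly (image_mset uminus w)"
    by (simp add: freq_poly_def e(1))
  ultimately show ?case by (simp only: reflect_poly_mult)
qed

lemma coeff_0_freq_poly: "coeff (freq_poly w) 0 = 1"
  by (induction w) (simp_all add: freq_poly_def coeff_mult_0)

lemma poly_shift_freq_poly_reverse:
  assumes "poly_shift (freq_poly w) z = (\<lambda>t. 0)"
  shows "poly_shift (freq_poly (image_mset uminus w)) (\<lambda>t. z (T - t)) = (\<lambda>t. 0)"
  using poly_shift_dvd[OF reflect_freq_poly_dvd] poly_shift_reflect_poly[OF _ assms]
  by (simp add: coeff_0_freq_poly)

section \<open>Fourier sums over the roots of unity\<close>

lemma roots_unity_norm:
  assumes "\<mu> \<in> roots_unity N" "N \<ge> 1"
  shows "norm \<mu> = 1"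
proof -
  have "norm \<mu> ^ N = 1 ^ N" using assms by (simp add: roots_unity_def flip: norm_power)
  thus ?thesis using assms(2) by (metis norm_ge_zero power_eq_imp_eq_base zero_le_one
        less_le_trans zero_less_one)
qed

lemma finite_roots_unity': "N \<ge> 1 \<Longrightarrow> finite (roots_unity N)"
  unfolding roots_unity_def by (intro finite_roots_unity) auto

lemma card_roots_unity': "N \<ge> 1 \<Longrightarrow> card (roots_unity N) = N"
  unfolding roots_unity_def by (intro card_roots_unity_eq) auto

text \<open>
  Multiplication by the primitive root \<open>\<nu>\<close> permutes the roots of unity and scales the sum by
  \<open>\<nu>\<^sup>k \<noteq> 1\<close>.
\<close>

lemma sum_roots_unity_power:
  assumes "0 < k" "k < N"
  shows "(\<Sum>\<mu>\<in>roots_unity N. \<mu> ^ k) = 0"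
proof -
  define \<nu> where "\<nu> = cis (2 * pi / real N)"
  have \<nu>: "\<nu> ^ j = cis (2 * pi * real j / real N)" for j
    by (simp add: \<nu>_def Complex.DeMoivre mult_ac)
  have \<nu>N: "\<nu> ^ N = 1" using assms by (simp add: \<nu>)
  have "inj_on (\<lambda>k. cis (2 * pi * real k / real N)) {..<N}"
    using bij_betw_roots_unity[of N] Complex.bij_betw_roots_unity[of N] assms
    by (auto simp: bij_betw_def)
  hence "\<nu> ^ k \<noteq> \<nu> ^ 0"
    unfolding \<nu> using assms by (auto dest: inj_onD[of _ _ k 0])
  moreover have "\<nu> \<noteq> 0" by (simp add: \<nu>_def)
  hence "(\<Sum>\<mu>\<in>roots_unity N. \<mu> ^ k) = (\<Sum>\<mu>\<in>roots_unity N. (\<nu> * \<mu>) ^ k)"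
    using \<nu>N by (intro sum.reindex_bij_witness[of _ "\<lambda>\<mu>. \<nu> * \<mu>" "\<lambda>\<mu>. \<mu> / \<nu>"])
      (auto simp: roots_unity_def power_mult_distrib power_divide)
  hence "(\<Sum>\<mu>\<in>roots_unity N. \<mu> ^ k) = \<nu> ^ k * (\<Sum>\<mu>\<in>roots_unity N. \<mu> ^ k)"
    unfolding power_mult_distrib sum_distrib_left .
  ultimately show ?thesis by simp
qed

lemma sum_roots_unity_cnj:
  assumes "u < N" "v < N"
  shows "(\<Sum>\<mu>\<in>roots_unity N. \<mu> ^ u * cnj \<mu> ^ v) = (if u = v then of_nat N else 0)"
proof -
  have N: "N \<ge> 1" using assms by simp
  note unit = unit_power_mult_cnj[OF roots_unity_norm[OF _ N]]
  consider "u = v" | "v < u" | "u < v" by linarith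
  thus ?thesis
  proof cases
    case 1
    thus ?thesis using N by (simp add: unit card_roots_unity')
  next
    case 2
    hence "(\<Sum>\<mu>\<in>roots_unity N. \<mu> ^ u * cnj \<mu> ^ v) = (\<Sum>\<mu>\<in>roots_unity N. \<mu> ^ (u - v))"
      by (intro sum.cong refl unit) auto
    thus ?thesis using 2 assms sum_roots_unity_power[of "u - v" N] by simp
  next
    case 3
    have "\<mu> ^ u * cnj \<mu> ^ v = cnj (\<mu> ^ (v - u))" if "\<mu> \<in> roots_unity N" for \<mu>
      using arg_cong[OF unit[OF that, of u v], of cnj] 3 by (simp add: mult.commute)
    hence "(\<Sum>\<mu>\<in>roots_unity N. \<mu> ^ u * cnj \<mu> ^ v) = cnj (\<Sum>\<mu>\<in>roots_unity N. \<mu> ^ (v - u))"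
      by (simp add: cnj_sum)
    thus ?thesis using 3 assms sum_roots_unity_power[of "v - u" N] by simp
  qed
qed

definition fourier_sum :: "nat \<Rightarrow> (int \<Rightarrow> complex) \<Rightarrow> complex \<Rightarrow> complex" where
  "fourier_sum N z \<mu> = (\<Sum>t<N. z (int t) * \<mu> ^ t)"

lemma fourier_inversion:
  assumes "u < N"
  shows "of_nat N * z (int u) = (\<Sum>\<mu>\<in>roots_unity N. fourier_sum N z \<mu> * cnj \<mu> ^ u)"
proof -
  have "(\<Sum>\<mu>\<in>roots_unity N. fourier_sum N z \<mu> * cnj \<mu> ^ u)
      = (\<Sum>t<N. z (int t) * (\<Sum>\<mu>\<in>roots_unity N. \<mu> ^ t * cnj \<mu> ^ u))"
    unfolding fourier_sum_def sum_distrib_left sum_distrib_right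
    by (subst sum.swap) (simp add: mult_ac)
  also have "\<dots> = (\<Sum>t<N. if t = u then z (int t) * of_nat N else 0)"
  proof (intro sum.cong refl)
    fix t assume "t \<in> {..<N}"
    hence "(\<Sum>\<mu>\<in>roots_unity N. \<mu> ^ t * cnj \<mu> ^ u) = (if t = u then of_nat N else 0)"
      using assms by (intro sum_roots_unity_cnj) auto
    thus "z (int t) * (\<Sum>\<mu>\<in>roots_unity N. \<mu> ^ t * cnj \<mu> ^ u)
        = (if t = u then z (int t) * of_nat N else 0)" by (simp only:) simp
  qed
  also have "\<dots> = of_nat N * z (int u)"
    using assms by simp
  finally show ?thesis by simp
qed

lemma sum_poly_roots_unity:
  assumes "degree f < N"
  shows "(\<Sum>\<mu>\<in>roots_unity N. poly f \<mu>) = of_nat N * poly f 0"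
proof -
  have "(\<Sum>\<mu>\<in>roots_unity N. poly f \<mu>)
      = (\<Sum>k\<le>degree f. coeff f k * (\<Sum>\<mu>\<in>roots_unity N. \<mu> ^ k))"
    unfolding poly_altdef sum_distrib_left by (rule sum.swap)
  also have "\<dots> = (\<Sum>k\<le>degree f. if k = 0 then coeff f 0 * of_nat N else 0)"
  proof (intro sum.cong refl)
    fix k assume "k \<in> {..degree f}"
    hence "(\<Sum>\<mu>\<in>roots_unity N. \<mu> ^ k) = (if k = 0 then of_nat N else 0)"
      using assms by (cases "k = 0") (simp_all add: card_roots_unity' sum_roots_unity_power)
    thus "coeff f k * (\<Sum>\<mu>\<in>roots_unity N. \<mu> ^ k) = (if k = 0 then coeff f 0 * of_nat N else 0)"
      by simp
  qed
  also have "\<dots> = of_nat N * poly f 0"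
    by (simp add: poly_0_coeff_0)
  finally show ?thesis .
qed

text \<open>
  The condition \<open>degree p \<le> t < N\<close> keeps all times \<open>t - k\<close> of the convolution inside the window,
  where the inversion formula holds; otherwise the right-hand side would describe the \<open>N\<close>-periodic
  extension of the window.
\<close>

lemma poly_shift_fourier:
  assumes "degree p \<le> t" "t < N"
  shows "of_nat N * poly_shift p z (int t)
       = (\<Sum>\<mu>\<in>roots_unity N. fourier_sum N z \<mu> * cnj \<mu> ^ t * poly p \<mu>)"
proof -
  have N: "N \<ge> 1" using assms by simp
  have unit: "cnj \<mu> ^ (t - k) = cnj \<mu> ^ t * \<mu> ^ k" if "\<mu> \<in> roots_unity N" "k \<le> t" for \<mu> k
  proof -
    show ?thesis
      using unit_power_mult_cnj[of "cnj \<mu>" k t] roots_unity_norm[OF that(1) N] that(2) by simp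
  qed
  have "of_nat N * poly_shift p z (int t)
      = (\<Sum>k\<le>degree p. coeff p k * (of_nat N * z (int (t - k))))"
    unfolding poly_shift_eq[OF order.refl] sum_distrib_left using assms
    by (intro sum.cong) (auto simp: of_nat_diff)
  also have "\<dots> = (\<Sum>k\<le>degree p. coeff p k *
      (\<Sum>\<mu>\<in>roots_unity N. fourier_sum N z \<mu> * cnj \<mu> ^ (t - k)))"
    using assms(2) by (intro sum.cong refl, subst fourier_inversion) simp_all
  also have "\<dots> = (\<Sum>\<mu>\<in>roots_unity N. \<Sum>k\<le>degree p.
      coeff p k * (fourier_sum N z \<mu> * cnj \<mu> ^ (t - k)))"
    unfolding sum_distrib_left by (rule sum.swap)
  also have "\<dots> = (\<Sum>\<mu>\<in>roots_unity N. fourier_sum N z \<mu> * cnj \<mu> ^ t * poly p \<mu>)"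
    unfolding poly_altdef sum_distrib_left using assms
    by (intro sum.cong refl) (auto simp: unit mult_ac)
  finally show ?thesis .
qed

section \<open>The lower bound\<close>

text \<open>
  A time in the second half of the window has at least about \<open>N/2\<close> predecessors in the window, so a
  filter of that length can be applied. For \<open>N < 48 d\<^sup>2\<close> plain Fourier inversion is enough;
  otherwise the filter \<open>(1 - f)\<^sup>2\<close> is used, with \<open>f\<close> as long as the available past permits.
\<close>

lemma late_value_bound:
  assumes ann: "poly_shift (freq_poly w) z = (\<lambda>t. 0)"
    and d: "size w = d" "d \<ge> 1" and t: "t < N" "N \<le> 2 * t + 1"
    and M: "\<And>\<mu>. \<mu> \<in> roots_unity N \<Longrightarrow> norm (fourier_sum N z \<mu>) \<le> M"
  shows "real N * norm (z (int t)) \<le> 48 * real d ^ 2 * M"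
proof -
  have N: "N \<ge> 1" using t by simp
  have "1 \<in> roots_unity N" by (simp add: roots_unity_def)
  with M have M0: "M \<ge> 0" by (meson norm_ge_zero order.trans)
  have nrm: "norm (cnj \<mu> ^ t) = 1" if "\<mu> \<in> roots_unity N" for \<mu>
    using roots_unity_norm[OF that N] by (simp add: norm_power)
  show ?thesis
  proof (cases "N < 48 * d ^ 2")
    case True
    have "real N * norm (z (int t)) = norm (of_nat N * z (int t))" by (simp add: norm_mult)
    also have "\<dots> \<le> (\<Sum>\<mu>\<in>roots_unity N. norm (fourier_sum N z \<mu> * cnj \<mu> ^ t))"
      unfolding fourier_inversion[OF t(1)] by (rule norm_sum)
    also have "\<dots> \<le> (\<Sum>\<mu>\<in>roots_unity N. M)"
      using M by (intro sum_mono) (simp add: norm_mult nrm)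
    also have "\<dots> = real N * M" using N by (simp add: card_roots_unity')
    also have "\<dots> \<le> real (48 * d ^ 2) * M"
      using True M0 by (intro mult_right_mono) (auto simp only: of_nat_le_iff)
    finally show ?thesis by simp
  next
    case False
    (* the largest n for which (1 - f)^2, of degree up to 6 d (n - 1), fits into the past of t *)
    define n where "n = t div (6 * d) + 1"
    have n_le: "6 * d * (n - 1) \<le> t"
      unfolding n_def by simp
    have "t < 6 * d * n"
      unfolding n_def using d(2) by (metis Suc_eq_plus1 dividend_less_times_div mult_Suc_right
          add.commute nat_0_less_mult_iff zero_less_numeral less_eq_Suc_le One_nat_def)
    hence Nn: "N < 12 * d * n" using t by simp
    with False have "48 * d ^ 2 < 12 * d * n" by linarith
    hence nd: "4 * d < n" by (simp add: power2_eq_square)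
    hence n2: "n \<ge> 2" using d by simp
    obtain f where f: "degree f \<le> 3 * (n - 1) * d" "poly f 0 = 1" "freq_poly w dvd f"
      "\<And>z. norm z = 1 \<Longrightarrow> norm (poly f z) \<le> (1 / (1 - 1 / real n)) ^ d"
      using exists_freq_poly_multiple[OF n2, of w] unfolding d(1) by blast
    define p where "p = (1 - f) ^ 2"
    have "degree p \<le> degree (1 - f) * 2" unfolding p_def by (rule degree_power_le)
    also have "degree (1 - f) \<le> 3 * (n - 1) * d" using f(1) by (intro degree_diff_le) auto
    also have "3 * (n - 1) * d * 2 = 6 * d * (n - 1)" by simp
    finally have dp: "degree p \<le> t" using n_le by simp
    have df: "degree f < N"
    proof -
      have "3 * (n - 1) * d \<le> 6 * d * (n - 1)" by simp
      thus ?thesis using f(1) n_le t(1) by linarith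
    qed
    (* p - 1 is a multiple of f, so the filter p reproduces the sequence *)
    have "poly_shift p z (int t) = z (int t)"
    proof -
      have "p = 1 + f * (f - 2)" by (simp add: p_def power2_eq_square algebra_simps)
      moreover have "poly_shift (f * (f - 2)) z = (\<lambda>t. 0)"
        using f(3) by (intro poly_shift_dvd[OF _ ann]) auto
      ultimately show ?thesis by (simp add: poly_shift_add poly_shift_1)
    qed
    hence "real N * norm (z (int t)) = norm (of_nat N * poly_shift p z (int t))"
      by (simp add: norm_mult)
    also have "\<dots> \<le> (\<Sum>\<mu>\<in>roots_unity N. norm (fourier_sum N z \<mu> * cnj \<mu> ^ t * poly p \<mu>))"
      unfolding poly_shift_fourier[OF dp t(1)] by (rule norm_sum)
    also have "\<dots> \<le> (\<Sum>\<mu>\<in>roots_unity N. M * norm (poly p \<mu>))"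
      using M by (intro sum_mono) (simp add: norm_mult nrm mult_right_mono)
    also have "\<dots> = M * (\<Sum>\<mu>\<in>roots_unity N. (norm (1 - poly f \<mu>))\<^sup>2)"
      by (simp add: p_def norm_power sum_distrib_left)
    also have "\<dots> \<le> M * (48 * real d ^ 2)"
    proof (intro mult_left_mono M0)
      define b where "b = 2 * real d / real n"
      have b: "0 \<le> b" "b \<le> 1 / 2" using nd by (auto simp: b_def field_simps)
      have sup: "(norm (poly f \<mu>))\<^sup>2 \<le> 1 / (1 - b)" if "\<mu> \<in> roots_unity N" for \<mu>
      proof -
        have "(norm (poly f \<mu>))\<^sup>2 \<le> ((1 / (1 - 1 / real n)) ^ d)\<^sup>2"
          using f(4) roots_unity_norm[OF that N] by (intro power_mono) auto
        also have "\<dots> = 1 / (1 - 1 / real n) ^ (2 * d)"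
          by (simp add: power_divide power_mult[symmetric] mult.commute)
        also have "\<dots> \<le> 1 / (1 - b)"
        proof (rule divide_left_mono)
          have "1 + real (2 * d) * (- 1 / real n) \<le> (1 + - 1 / real n) ^ (2 * d)"
            using n2 by (intro Bernoulli_inequality) (simp add: field_simps)
          thus "1 - b \<le> (1 - 1 / real n) ^ (2 * d)" by (simp add: b_def)
          show "0 < (1 - 1 / real n) ^ (2 * d) * (1 - b)"
            using n2 b by (intro mult_pos_pos zero_less_power) (auto simp: field_simps)
        qed simp
        finally show ?thesis .
      qed
      have "(\<Sum>\<mu>\<in>roots_unity N. (norm (1 - poly f \<mu>))\<^sup>2)
          = (\<Sum>\<mu>\<in>roots_unity N. 1 + (norm (poly f \<mu>))\<^sup>2 - 2 * Re (poly f \<mu>))"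
        by (intro sum.cong refl) (simp only: cmod_power2, simp add: power2_eq_square algebra_simps)
      also have "\<dots> = real N + (\<Sum>\<mu>\<in>roots_unity N. (norm (poly f \<mu>))\<^sup>2)
          - 2 * Re (\<Sum>\<mu>\<in>roots_unity N. poly f \<mu>)"
        using N by (simp add: sum.distrib sum_subtractf card_roots_unity' sum_distrib_left)
      (* the mean of f over the roots of unity is f(0) = 1 *)
      also have "\<dots> = (\<Sum>\<mu>\<in>roots_unity N. (norm (poly f \<mu>))\<^sup>2) - real N"
        by (simp add: sum_poly_roots_unity[OF df] f(2))
      also have "\<dots> \<le> (\<Sum>\<mu>\<in>roots_unity N. 1 / (1 - b)) - real N"
        using sup by (intro diff_right_mono sum_mono)
      also have "\<dots> = real N * (b / (1 - b))"
        using N b by (simp add: card_roots_unity' field_simps)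
      also have "\<dots> \<le> real N * (2 * b)"
      proof (intro mult_left_mono)
        have "b * 1 \<le> b * (2 * (1 - b))" using b by (intro mult_left_mono) auto
        thus "b / (1 - b) \<le> 2 * b" using b by (simp add: field_simps)
      qed simp
      also have "\<dots> \<le> real (12 * d * n) * (2 * b)"
        using Nn b by (intro mult_right_mono) (auto simp only: of_nat_le_iff)
      also have "\<dots> = 48 * real d ^ 2"
        using n2 by (simp add: b_def power2_eq_square)
      finally show "(\<Sum>\<mu>\<in>roots_unity N. (norm (1 - poly f \<mu>))\<^sup>2) \<le> 48 * real d ^ 2" .
    qed
    finally show ?thesis by (simp add: mult_ac)
  qed
qed

lemma norm_fourier_sum_reverse:
  assumes "\<mu> \<in> roots_unity N" "N \<ge> 1"
  shows "norm (fourier_sum N (\<lambda>t. z (int N - 1 - t)) \<mu>) = norm (fourier_sum N z (cnj \<mu>))"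
proof -
  have n: "norm \<mu> = 1" using roots_unity_norm[OF assms] .
  have "fourier_sum N (\<lambda>t. z (int N - 1 - t)) \<mu> = (\<Sum>t<N. z (int t) * \<mu> ^ (N - 1 - t))"
    unfolding fourier_sum_def
    by (rule sum.reindex_bij_witness[of _ "\<lambda>t. N - 1 - t" "\<lambda>t. N - 1 - t"])
       (auto simp: of_nat_diff algebra_simps)
  also have "\<dots> = (\<Sum>t<N. \<mu> ^ (N - 1) * (z (int t) * cnj \<mu> ^ t))"
  proof (intro sum.cong refl)
    fix t assume "t \<in> {..<N}"
    hence "\<mu> ^ (N - 1) * cnj \<mu> ^ t = \<mu> ^ (N - 1 - t)"
      using n by (intro unit_power_mult_cnj) auto
    thus "z (int t) * \<mu> ^ (N - 1 - t) = \<mu> ^ (N - 1) * (z (int t) * cnj \<mu> ^ t)"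
      by (simp only: mult.left_commute)
  qed
  also have "\<dots> = \<mu> ^ (N - 1) * fourier_sum N z (cnj \<mu>)"
    by (simp add: fourier_sum_def sum_distrib_left)
  finally show ?thesis using n by (simp add: norm_mult norm_power)
qed

text \<open>
  For a time in the first half of the window, the past is too short but the future is long enough;
  reversing the window exchanges the two, and only permutes the moduli of the Fourier sums.
\<close>

lemma value_bound:
  assumes ann: "poly_shift (freq_poly w) z = (\<lambda>t. 0)"
    and d: "size w = d" "d \<ge> 1" and t: "t < N"
    and M: "\<And>\<mu>. \<mu> \<in> roots_unity N \<Longrightarrow> norm (fourier_sum N z \<mu>) \<le> M"
  shows "real N * norm (z (int t)) \<le> 48 * real d ^ 2 * M"
proof (cases "N \<le> 2 * t + 1")
  case True
  show ?thesis using late_value_bound[OF ann d t True M] .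
next
  case False
  have "real N * norm ((\<lambda>t. z (int N - 1 - t)) (int (N - 1 - t))) \<le> 48 * real d ^ 2 * M"
  proof (rule late_value_bound[OF poly_shift_freq_poly_reverse[OF ann]])
    fix \<mu> assume \<mu>: "\<mu> \<in> roots_unity N"
    hence "cnj \<mu> \<in> roots_unity N" by (simp add: roots_unity_def flip: complex_cnj_power)
    thus "norm (fourier_sum N (\<lambda>t. z (int N - 1 - t)) \<mu>) \<le> M"
      using M \<mu> t by (simp add: norm_fourier_sum_reverse)
  qed (use d t False in auto)
  thus ?thesis using t by (simp add: of_nat_diff)
qed

lemma DFT_sup_norm_ge:
  assumes "d \<ge> 1" "N \<ge> 1" "s \<in> S_dim d"
  shows "DFT_sup_norm N s \<ge> 1 / (48 * real d ^ 2) * sqrt (real N) * segment_sup_norm N s"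
proof -
  define z where "z = (\<lambda>t. complex_of_real (s t))"
  obtain w where w: "size w = d" "poly_shift (freq_poly w) z = (\<lambda>t. 0)"
    using assms(3) by (auto simp: S_dim_def S_freq_def Omega_def z_def)
  have M: "norm (fourier_sum N z \<mu>) \<le> sqrt (real N) * DFT_sup_norm N s"
    if "\<mu> \<in> roots_unity N" for \<mu>
  proof -
    have "norm (DFT N s \<mu>) \<le> DFT_sup_norm N s"
      unfolding DFT_sup_norm_def using that finite_roots_unity'[OF assms(2)] by (intro Max_ge) auto
    moreover have "norm (DFT N s \<mu>) = norm (fourier_sum N z \<mu>) / sqrt (real N)"
      by (simp add: DFT_def fourier_sum_def z_def norm_mult norm_divide)
    ultimately show ?thesis using assms(2) by (simp add: field_simps)
  qed
  have "segment_sup_norm N s \<in> (\<lambda>t. \<bar>s (int t)\<bar>) ` {..<N}"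
    unfolding segment_sup_norm_def using assms(2) by (intro Max_in) (auto simp: lessThan_empty_iff)
  then obtain t where t: "t < N" "segment_sup_norm N s = norm (z (int t))"
    by (auto simp: z_def)
  have "real N * norm (z (int t)) \<le> 48 * real d ^ 2 * (sqrt (real N) * DFT_sup_norm N s)"
    by (rule value_bound[OF w(2,1) assms(1) t(1) M])
  moreover have "real N * norm (z (int t)) = sqrt (real N) * (sqrt (real N) * norm (z (int t)))"
    unfolding mult.assoc[symmetric] by simp
  ultimately have "sqrt (real N) * (sqrt (real N) * norm (z (int t)))
      \<le> sqrt (real N) * (48 * real d ^ 2 * DFT_sup_norm N s)"
    by (simp only: mult.left_commute)
  hence "sqrt (real N) * norm (z (int t)) \<le> 48 * real d ^ 2 * DFT_sup_norm N s"
    by (rule mult_left_le_imp_le) (use assms(2) in simp)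
  thus ?thesis using assms(1) t(2) by (simp add: field_simps)
qed

theorem proposition6p1:
  shows "(\<exists>c :: nat \<Rightarrow> real. DFT_lower_factor c) \<and>
         (\<exists>\<kappa> :: real. \<kappa> > 0 \<and>
            DFT_lower_factor (\<lambda>d. \<kappa> / (real d ^ 3 * ln (2 * real d))))"
proof -
  define \<kappa> :: real where "\<kappa> = ln 2 / 48"
  define c where "c = (\<lambda>d. \<kappa> / (real d ^ 3 * ln (2 * real d)))"
  have \<kappa>: "\<kappa> > 0" by (simp add: \<kappa>_def)
  have pos: "0 < real d ^ 3 * ln (2 * real d)" if "d \<ge> 1" for d
    using that by (intro mult_pos_pos) auto
  have "DFT_lower_factor c"
    unfolding DFT_lower_factor_def
  proof (intro conjI allI impI ballI)
    fix d :: nat assume "d \<ge> 1"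
    thus "c d > 0" using \<kappa> pos by (simp add: c_def)
  next
    show "antimono_on {1..} c"
    proof (intro monotone_onI)
      fix d e :: nat assume de: "d \<in> {1..}" "e \<in> {1..}" "d \<le> e"
      have "real d ^ 3 * ln (2 * real d) \<le> real e ^ 3 * ln (2 * real e)"
        using de by (intro mult_mono power_mono) auto
      thus "c e \<le> c d"
        using \<kappa> pos de unfolding c_def by (intro divide_left_mono mult_pos_pos) auto
    qed
  next
    fix d N :: nat and s assume *: "d \<ge> 1" "N \<ge> 1" "s \<in> S_dim d"
    have "ln 2 \<le> ln (2 * real d)" using *(1) by simp
    hence "1 * ln 2 \<le> real d * ln (2 * real d)" using *(1) by (intro mult_mono) auto
    hence "real d ^ 2 * ln 2 \<le> real d ^ 2 * (real d * ln (2 * real d))"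
      by (intro mult_left_mono) auto
    hence "c d \<le> 1 / (48 * real d ^ 2)"
      using pos[OF *(1)] *(1) unfolding c_def \<kappa>_def
      by (simp add: field_simps power2_eq_square power3_eq_cube)
    moreover have "\<bar>s (int 0)\<bar> \<le> segment_sup_norm N s"
      unfolding segment_sup_norm_def using *(2) by (intro Max_ge imageI) auto
    hence "0 \<le> segment_sup_norm N s" by linarith
    ultimately have "c d * sqrt (real N) * segment_sup_norm N s
        \<le> 1 / (48 * real d ^ 2) * sqrt (real N) * segment_sup_norm N s"
      by (intro mult_right_mono) auto
    thus "DFT_sup_norm N s \<ge> c d * sqrt (real N) * segment_sup_norm N s"
      using DFT_sup_norm_ge[OF *] by linarith
  qed
  thus ?thesis using \<kappa> unfolding c_def by blast
qed

end
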